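(* For every $t>0$, $$E\Big[\exp\Big(\frac{2}{A_t}\Big)\Big]=\infty.$$
   Context: $(B_t)_{t\ge 0}$ is a standard one-dimensional Brownian motion started at $0$, $M_t=\exp(B_t-t/2)$, and $A_t=\int_0^t M_s\,ds$. *)

theory Defs
  imports "HOL-Probability.Probability"
begin

text \<open>
  Standard one-dimensional Brownian motion on a probability space \<open>P\<close>, indexed by
  \<open>t \<ge> 0\<close>; the values of \<open>B\<close> at negative times are irrelevant.  The initial condition and
  the continuity of paths are required almost surely only.  The second parameter of
  \<^const>\<open>normal_density\<close> is the standard deviation, not the variance.
\<close>

locale standard_brownian_motion = prob_space P
  for P :: "'a measure" and B :: "real \<Rightarrow> 'a \<Rightarrow> real" +
  assumes random_variable_B: "\<And>t. 0 \<le> t \<Longrightarrow> random_variable borel (B t)"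
    and starts_at_zero: "AE \<omega> in P. B 0 \<omega> = 0"
    and independent_increments:
      "\<And>(n :: nat) (\<tau> :: nat \<Rightarrow> real). 0 \<le> \<tau> 0 \<Longrightarrow> (\<And>i. i < n \<Longrightarrow> \<tau> i < \<tau> (Suc i)) \<Longrightarrow>
        indep_vars (\<lambda>_. borel) (\<lambda>i \<omega>. B (\<tau> (Suc i)) \<omega> - B (\<tau> i) \<omega>) {..<n}"
    and gaussian_increments:
      "\<And>s t. 0 \<le> s \<Longrightarrow> s < t \<Longrightarrow>
        distributed P lborel (\<lambda>\<omega>. B t \<omega> - B s \<omega>) (normal_density 0 (sqrt (t - s)))"
    and continuous_paths: "AE \<omega> in P. continuous_on {0..} (\<lambda>t. B t \<omega>)"

definition exp_martingale :: "(real \<Rightarrow> 'a \<Rightarrow> real) \<Rightarrow> real \<Rightarrow> 'a \<Rightarrow> real" where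
  "exp_martingale B t \<omega> = exp (B t \<omega> - t / 2)"

definition exp_functional :: "(real \<Rightarrow> 'a \<Rightarrow> real) \<Rightarrow> real \<Rightarrow> 'a \<Rightarrow> real" where
  "exp_functional B t \<omega> = (LBINT s:{0..t}. exp_martingale B s \<omega>)"

end

theory Submission imports Defs begin

text \<open>
  For \<open>\<alpha> > 0\<close> put \<open>Z = \<alpha> M / (1 - \<alpha> A)\<close> until \<open>A\<close> reaches \<open>1 / \<alpha>\<close>. Then \<open>exp (- 2 Z)\<close>, set to
  \<open>0\<close> afterwards, is a bounded martingale started at \<open>exp (- 2 \<alpha>)\<close>, and it is at most the
  indicator of \<open>A < 1 / \<alpha>\<close>. Hence \<open>P (1 / A\<^sub>t \<ge> \<alpha>) \<ge> exp (- 2 \<alpha>)\<close>, so \<open>exp (2 / A\<^sub>t)\<close>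
  exceeds \<open>x\<close> with probability at least \<open>1 / x\<close> and cannot be integrable. Stochastic calculus is
  avoided by replacing \<open>A\<close> by left Riemann sums of mesh \<open>\<delta>\<close>: the martingale property then holds up
  to an error \<open>O(\<delta>\<^sup>2)\<close> per step, uniformly in the state, and this vanishes in the limit.
\<close>

subsection \<open>Lognormal increments\<close>

text \<open>The fourth-order Lagrange remainder is an even power times a positive factor, hence
  nonnegative for either sign of \<open>y\<close>. Both signs occur later, at
  \<open>y = w * (X x - 1)\<close>.\<close>

lemma exp_minus_ge_cubic: "1 - y + y\<^sup>2 / 2 - y ^ 3 / 6 \<le> exp (- y)" for y :: real
proof -
  obtain s where "exp (- y) = (\<Sum>m<4. (- y) ^ m / fact m) + exp s / fact 4 * (- y) ^ 4"
    using Maclaurin_exp_le[of "- y" 4] by blast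
  moreover have "exp s / fact 4 * (- y) ^ 4 \<ge> 0"
    by simp
  moreover have "(\<Sum>m<4. (- y) ^ m / fact m) = 1 - y + y\<^sup>2 / 2 - y ^ 3 / 6"
    by (simp add: eval_nat_numeral)
  ultimately show ?thesis
    by linarith
qed

text \<open>\<open>y ^ k / fact k\<close> is a single term of the series of \<open>exp y\<close>.
  This is what makes the errors below uniform in the state: polynomial growth is absorbed by the
  exponential.\<close>

lemma power_mult_exp_minus_le_fact: "y ^ k * exp (- y) \<le> fact k" if "0 \<le> y" for y :: real
proof -
  obtain s where "exp y = (\<Sum>m<Suc k. y ^ m / fact m) + exp s / fact (Suc k) * y ^ Suc k"
    using Maclaurin_exp_le[of y "Suc k"] by blast
  moreover have "exp s / fact (Suc k) * y ^ Suc k \<ge> 0" "(\<Sum>m<k. y ^ m / fact m) \<ge> 0"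
    using that by (auto intro!: sum_nonneg)
  ultimately have "y ^ k / fact k \<le> exp y"
    by simp
  then show ?thesis
    by (simp add: exp_minus field_simps)
qed

text \<open>Completing the square: tilting by \<open>exp (c * x)\<close> moves the mean to
  \<open>c * \<sigma>\<^sup>2\<close> and leaves a constant factor.\<close>

lemma normal_exp_moment:
  fixes \<sigma> :: real
  assumes "\<sigma> > 0"
  shows "has_bochner_integral (density lborel (normal_density 0 \<sigma>)) (\<lambda>x. exp (c * x))
    (exp (c\<^sup>2 * \<sigma>\<^sup>2 / 2))"
proof -
  have eq: "normal_density 0 \<sigma> x * exp (c * x)
      = exp (c\<^sup>2 * \<sigma>\<^sup>2 / 2) * normal_density (c * \<sigma>\<^sup>2) \<sigma> x" for x
  proof -
    have "- (x - 0)\<^sup>2 / (2 * \<sigma>\<^sup>2) + c * x = c\<^sup>2 * \<sigma>\<^sup>2 / 2 + - (x - c * \<sigma>\<^sup>2)\<^sup>2 / (2 * \<sigma>\<^sup>2)"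
      using assms by (simp add: field_simps power2_eq_square)
    then have "exp (- (x - 0)\<^sup>2 / (2 * \<sigma>\<^sup>2)) * exp (c * x)
        = exp (c\<^sup>2 * \<sigma>\<^sup>2 / 2) * exp (- (x - c * \<sigma>\<^sup>2)\<^sup>2 / (2 * \<sigma>\<^sup>2))"
      by (simp add: exp_add[symmetric])
    then show ?thesis
      by (simp add: normal_density_def)
  qed
  have "has_bochner_integral lborel (normal_density (c * \<sigma>\<^sup>2) \<sigma>) 1"
    using assms by (simp add: has_bochner_integral_iff)
  from has_bochner_integral_mult_right[OF this, of "exp (c\<^sup>2 * \<sigma>\<^sup>2 / 2)"]
  show ?thesis
    by (intro has_bochner_integral_density) (auto simp: eq[symmetric])
qed

lemma lognormal_moment:
  fixes \<delta> :: real
  assumes "\<delta> > 0"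
  shows "has_bochner_integral (density lborel (normal_density 0 (sqrt \<delta>)))
    (\<lambda>x. exp (x - \<delta> / 2) ^ k) (exp ((real k * real k - real k) * \<delta> / 2))"
proof -
  have "has_bochner_integral (density lborel (normal_density 0 (sqrt \<delta>)))
    (\<lambda>x. exp (- real k * \<delta> / 2) * exp (real k * x))
    (exp (- real k * \<delta> / 2) * exp ((real k)\<^sup>2 * (sqrt \<delta>)\<^sup>2 / 2))"
    by (intro has_bochner_integral_mult_right normal_exp_moment) (use assms in auto)
  moreover have "exp (- real k * \<delta> / 2) * exp (real k * x) = exp (x - \<delta> / 2) ^ k" for x
    by (simp add: exp_add[symmetric] exp_of_nat_mult[symmetric] algebra_simps)
  moreover have "exp (- real k * \<delta> / 2) * exp ((real k)\<^sup>2 * (sqrt \<delta>)\<^sup>2 / 2)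
      = exp ((real k * real k - real k) * \<delta> / 2)"
    using assms by (simp add: exp_add[symmetric] power2_eq_square algebra_simps diff_divide_distrib)
  ultimately show ?thesis
    by simp
qed

lemma exp_minus_one_le_double: "exp \<delta> - 1 \<le> 2 * \<delta>" if "0 \<le> \<delta>" "\<delta> \<le> 1" for \<delta> :: real
  using exp_bound[OF that] that mult_left_le[of \<delta> \<delta>] by (simp add: power2_eq_square)

text \<open>Taylor expansion around the mean 1 of the lognormal factor. Its variance
  \<open>exp \<delta> - 1 \<ge> \<delta>\<close> yields the quadratic term, its third central moment
  is already of order \<delta>^2, and stopping at the cubic term leaves a lower bound. The factor
  \<open>exp (- w)\<close> makes the error uniform in \<open>w\<close>.\<close>

lemma lognormal_laplace_lower:
  fixes \<delta> w :: real
  assumes \<delta>: "0 < \<delta>" "\<delta> \<le> 1" and w: "0 \<le> w"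
  shows "exp (- w) * (1 + w\<^sup>2 * \<delta> / 2) - 20 * \<delta>\<^sup>2
    \<le> (\<integral>x. exp (- (w * exp (x - \<delta> / 2))) \<partial>density lborel (normal_density 0 (sqrt \<delta>)))"
proof -
  define N where "N = density lborel (normal_density 0 (sqrt \<delta>))"
  interpret N: prob_space N
    unfolding N_def using \<delta> by (intro prob_space_normal_density) auto
  \<comment> \<open>The third central moment of \<open>X\<close>: exp(3\<delta>) - 3 exp(\<delta>) +
    3 - 1.\<close>
  define m3 where "m3 = exp (3 * \<delta>) - 3 * exp \<delta> + 2"
  define X where "X x = exp (x - \<delta> / 2)" for x
  have [measurable]: "X \<in> borel_measurable N"
    unfolding X_def N_def by simp
  have m: "has_bochner_integral N (\<lambda>x. X x ^ k) (exp ((real k * real k - real k) * \<delta> / 2))" for k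
    unfolding N_def X_def by (rule lognormal_moment) fact
  \<comment> \<open>The cubic is first written in powers of \<open>X\<close>, whose moments of
    orders 0 to 3 are 1, 1, exp(\<delta>), exp(3\<delta>); \<open>poly_eq\<close> and
    \<open>val_eq\<close> then recentre it at 1.\<close>
  have mom: "has_bochner_integral N (\<lambda>x. exp (- w) * ((1 + w + w\<^sup>2 / 2 + w ^ 3 / 6) * X x ^ 0
      - (w + w\<^sup>2 + w ^ 3 / 2) * X x ^ 1 + (w\<^sup>2 / 2 + w ^ 3 / 2) * X x ^ 2 - w ^ 3 / 6 * X x ^ 3))
    (exp (- w) * ((1 + w + w\<^sup>2 / 2 + w ^ 3 / 6) * 1 - (w + w\<^sup>2 + w ^ 3 / 2) * 1
      + (w\<^sup>2 / 2 + w ^ 3 / 2) * exp \<delta> - w ^ 3 / 6 * exp (3 * \<delta>)))"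
    by (intro has_bochner_integral_mult_right has_bochner_integral_diff has_bochner_integral_add)
      (use m[of 0] m[of 1] m[of 2] m[of 3] in simp_all)
  have poly_eq: "(1 + w + w\<^sup>2 / 2 + w ^ 3 / 6) * X x ^ 0
      - (w + w\<^sup>2 + w ^ 3 / 2) * X x ^ 1 + (w\<^sup>2 / 2 + w ^ 3 / 2) * X x ^ 2 - w ^ 3 / 6 * X x ^ 3
    = 1 - w * (X x - 1) + (w * (X x - 1))\<^sup>2 / 2 - (w * (X x - 1)) ^ 3 / 6" for x
    by (simp add: field_simps eval_nat_numeral)
  have val_eq: "(1 + w + w\<^sup>2 / 2 + w ^ 3 / 6) * 1 - (w + w\<^sup>2 + w ^ 3 / 2) * 1
      + (w\<^sup>2 / 2 + w ^ 3 / 2) * exp \<delta> - w ^ 3 / 6 * exp (3 * \<delta>)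
    = 1 + w\<^sup>2 / 2 * (exp \<delta> - 1) - w ^ 3 / 6 * m3"
    by (simp add: m3_def field_simps)
  have poly: "has_bochner_integral N
      (\<lambda>x. exp (- w) * (1 - w * (X x - 1) + (w * (X x - 1))\<^sup>2 / 2 - (w * (X x - 1)) ^ 3 / 6))
      (exp (- w) * (1 + w\<^sup>2 / 2 * (exp \<delta> - 1) - w ^ 3 / 6 * m3))"
    using mom unfolding poly_eq val_eq .
  have int: "integrable N (\<lambda>x. exp (- (w * X x)))"
    by (rule N.integrable_const_bound[of _ 1]) (use w in \<open>simp add: X_def\<close>, measurable)
  have "exp (- w) * (1 + w\<^sup>2 / 2 * (exp \<delta> - 1) - w ^ 3 / 6 * m3) \<le> (\<integral>x. exp (- (w * X x)) \<partial>N)"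
  proof (subst has_bochner_integral_integral_eq[OF poly, symmetric], rule integral_mono)
    fix x
    have "exp (- (w * X x)) = exp (- w) * exp (- (w * (X x - 1)))"
      by (simp add: exp_add[symmetric] algebra_simps)
    then show "exp (- w) * (1 - w * (X x - 1) + (w * (X x - 1))\<^sup>2 / 2 - (w * (X x - 1)) ^ 3 / 6)
        \<le> exp (- (w * X x))"
      using exp_minus_ge_cubic[of "w * (X x - 1)"] by simp
  qed (use poly int in \<open>auto simp: has_bochner_integral_iff\<close>)
  moreover have "w\<^sup>2 / 2 * \<delta> \<le> w\<^sup>2 / 2 * (exp \<delta> - 1)"
    using exp_ge_add_one_self[of \<delta>] by (intro mult_left_mono) (linarith, simp)
  moreover have "exp (- w) * (w ^ 3 / 6 * m3) \<le> 20 * \<delta>\<^sup>2"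
  proof -
    \<comment> \<open>The double zero at \<open>exp \<delta> = 1\<close> gives the order \<delta>^2;
      the constant is 20 = 4 * 5, since \<open>exp \<delta> + 2 \<le> 5\<close>.\<close>
    have m3_eq: "m3 = (exp \<delta> - 1)\<^sup>2 * (exp \<delta> + 2)"
    proof -
      have "exp (3 * \<delta>) = exp \<delta> ^ 3"
        using exp_of_nat_mult[of 3 \<delta>] by simp
      then show ?thesis
        by (simp add: m3_def power2_eq_square power3_eq_cube algebra_simps)
    qed
    also have "\<dots> \<le> (2 * \<delta>)\<^sup>2 * 5"
      using exp_minus_one_le_double[of \<delta>] \<delta> by (intro mult_mono power_mono) auto
    finally have "m3 \<le> 20 * \<delta>\<^sup>2"
      by simp
    moreover have "w ^ 3 * exp (- w) / 6 \<le> 1"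
      using power_mult_exp_minus_le_fact[of w 3] w by (simp add: eval_nat_numeral)
    ultimately have "w ^ 3 * exp (- w) / 6 * m3 \<le> 1 * (20 * \<delta>\<^sup>2)"
      using w by (intro mult_mono') (auto simp: m3_eq)
    then show ?thesis
      by (simp add: mult_ac)
  qed
  moreover have "exp (- w) * (1 + w\<^sup>2 / 2 * \<delta>) \<le> exp (- w) * (1 + w\<^sup>2 / 2 * (exp \<delta> - 1))"
    using calculation(2) by (intro mult_left_mono) auto
  moreover have "exp (- w) * (1 + w\<^sup>2 / 2 * (exp \<delta> - 1) - w ^ 3 / 6 * m3)
      = exp (- w) * (1 + w\<^sup>2 / 2 * (exp \<delta> - 1)) - exp (- w) * (w ^ 3 / 6 * m3)"
    by (rule right_diff_distrib)
  ultimately show ?thesis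
    unfolding N_def X_def times_divide_eq_left by linarith
qed

subsection \<open>The killed chain\<close>

text \<open>For a left Riemann sum \<open>A\<close> of \<open>M\<close> with mesh \<open>\<delta>\<close>, the ratio \<open>\<alpha> M / (1 - \<alpha> A)\<close> evolves by
  \<open>ratio_step\<close>. Once \<open>\<alpha> A\<close> reaches \<open>1\<close> the state drops to \<open>\<le> 0\<close> (division by zero gives \<open>0\<close>)
  and stays there, so nonpositive states encode explosion.\<close>

definition ratio_step :: "real \<Rightarrow> real \<Rightarrow> real \<Rightarrow> real" where
  "ratio_step \<delta> z x = z * exp (x - \<delta> / 2) / (1 - \<delta> * z)"

definition killed_exp :: "real \<Rightarrow> real" where
  "killed_exp z = (if z > 0 then exp (- (2 * z)) else 0)"

lemma killed_exp_measurable [measurable]: "killed_exp \<in> borel_measurable borel"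
  unfolding killed_exp_def by measurable

text \<open>Only the submartingale half of the martingale property, up to the error, is needed for a
  lower bound on survival. It rests on a first-order cancellation: dividing by
  \<open>1 - \<delta> * z\<close> lowers the exponential by a relative amount of at most about
  \<delta> w^2 / 2, and the variance of the lognormal factor restores that much.\<close>

lemma killed_exp_le_step:
  fixes \<delta> z :: real
  assumes \<delta>: "0 < \<delta>" "\<delta> \<le> 1"
  shows "ennreal (killed_exp z)
    \<le> (\<integral>\<^sup>+x. ennreal (killed_exp (ratio_step \<delta> z x)) \<partial>density lborel (normal_density 0 (sqrt \<delta>)))
      + ennreal (60 * \<delta>\<^sup>2)"
    (is "_ \<le> ?T + _")
proof -
  \<comment> \<open>A dead state contributes 0; a state above 1 / (3\<delta>) has a value of order
    \<delta>^2 by itself; below that threshold \<open>1 - \<delta> * z \<ge> 2 / 3\<close>, so the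
    next state is alive and the expansion applies.\<close>
  consider "z \<le> 0" | "z > 0" "3 * \<delta> * z > 1" | "z > 0" "3 * \<delta> * z \<le> 1"
    by linarith
  then show ?thesis
  proof cases
    case 1
    then show ?thesis by (simp add: killed_exp_def)
  next
    case 2
    have "1 * exp (- (2 * z)) \<le> (3 * \<delta> * z)\<^sup>2 * exp (- (2 * z))"
      using 2 by (intro mult_right_mono) (auto simp: one_le_power)
    also have "\<dots> = 9 * \<delta>\<^sup>2 / 4 * ((2 * z) ^ 2 * exp (- (2 * z)))"
      by (simp add: power_mult_distrib)
    also have "\<dots> \<le> 9 * \<delta>\<^sup>2 / 4 * fact 2"
      using 2 by (intro mult_left_mono power_mult_exp_minus_le_fact) auto
    also have "\<dots> \<le> 60 * \<delta>\<^sup>2"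
      by (simp add: eval_nat_numeral)
    finally have "ennreal (killed_exp z) \<le> ennreal (60 * \<delta>\<^sup>2)"
      using 2 by (intro ennreal_leI) (simp add: killed_exp_def)
    then show ?thesis
      by (rule add_increasing[rotated]) simp
  next
    case 3
    \<comment> \<open>Chosen so that
      \<open>2 * ratio_step \<delta> z x = w * exp (x - \<delta> / 2)\<close>; the gap
      \<open>y\<close> equals \<open>\<delta> * z * w\<close>.\<close>
    define w where "w = 2 * z / (1 - \<delta> * z)"
    define y where "y = w - 2 * z"
    have d: "1 - \<delta> * z \<ge> 2 / 3"
      using 3 by simp
    have w_eq: "w = 2 * z + \<delta> * z * w"
      using d by (simp add: w_def field_simps)
    have w: "w \<ge> 2 * z" "w \<le> 3 * z"
    proof -
      show "w \<ge> 2 * z"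
        using 3 d \<delta> by (simp add: w_def le_divide_eq)
      have "2 * z \<le> 3 * z * (1 - \<delta> * z)"
        using mult_left_mono[OF d, of "3 * z"] 3 by simp
      then show "w \<le> 3 * z"
        using d by (simp add: w_def divide_le_eq)
    qed
    have y: "0 \<le> y" "y \<le> \<delta> * w\<^sup>2 / 2" "y \<le> 3 * \<delta> * z\<^sup>2"
    proof -
      have "y = \<delta> * z * w"
        using w_eq y_def by linarith
      moreover have "\<delta> * w * z \<le> \<delta> * w * (w / 2)" "\<delta> * z * w \<le> \<delta> * z * (3 * z)"
        using w 3 \<delta> by (auto intro!: mult_left_mono)
      ultimately show "0 \<le> y" "y \<le> \<delta> * w\<^sup>2 / 2" "y \<le> 3 * \<delta> * z\<^sup>2"
        using w 3 \<delta> by (auto simp: power2_eq_square mult_ac)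
    qed
    \<comment> \<open>The bound \<open>exp y \<le> 1 + y * exp y\<close> is inserted into itself.
      The remainder keeps the factor \<open>exp y\<close> because
      \<open>exp (- w) * exp y = exp (- (2 * z))\<close>, whose decay absorbs
      \<open>y\<^sup>2\<close>, which is of order \<delta>^2 z^4.\<close>
    have exp_y: "exp y \<le> 1 + y + y\<^sup>2 * exp y"
    proof -
      have "1 - y \<le> exp (- y)"
        using exp_ge_add_one_self[of "- y"] by simp
      then have "exp y * (1 - y) \<le> 1"
        using mult_left_mono[of "1 - y" "exp (- y)" "exp y"] by (simp add: exp_minus)
      then have "exp y \<le> 1 + y * exp y"
        by (simp add: algebra_simps)
      moreover from this have "y * exp y \<le> y * (1 + y * exp y)"
        using y by (intro mult_left_mono)
      ultimately show ?thesis
        by (simp add: algebra_simps power2_eq_square)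
    qed
    have "exp (- (2 * z)) = exp (- w) * exp y"
      by (simp add: exp_add[symmetric] y_def)
    also have "\<dots> \<le> exp (- w) * (1 + y + y\<^sup>2 * exp y)"
      using exp_y by (intro mult_left_mono) auto
    also have "\<dots> = exp (- w) * (1 + y) + y\<^sup>2 * exp (- (2 * z))"
      by (simp add: algebra_simps y_def exp_add[symmetric])
    also have "y\<^sup>2 * exp (- (2 * z)) \<le> (3 * \<delta> * z\<^sup>2)\<^sup>2 * exp (- (2 * z))"
      using y by (intro mult_right_mono power_mono) auto
    also have "\<dots> = 9 * \<delta>\<^sup>2 / 16 * ((2 * z) ^ 4 * exp (- (2 * z)))"
      by (simp add: power_mult_distrib eval_nat_numeral)
    also have "\<dots> \<le> 9 * \<delta>\<^sup>2 / 16 * fact 4"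
      using 3 by (intro mult_left_mono power_mult_exp_minus_le_fact) auto
    also have "\<dots> \<le> 20 * \<delta>\<^sup>2"
      by (simp add: eval_nat_numeral)
    also have "exp (- w) * (1 + y) \<le> exp (- w) * (1 + w\<^sup>2 * \<delta> / 2)"
      using y by (intro mult_left_mono) (auto simp: mult_ac)
    finally have "exp (- (2 * z)) \<le> exp (- w) * (1 + w\<^sup>2 * \<delta> / 2) + 20 * \<delta>\<^sup>2"
      by simp
    \<comment> \<open>Two errors of 20 \<delta>^2, from the remainder above and from the Laplace
      bound, fit into 60 \<delta>^2.\<close>
    also have "\<dots> \<le> (\<integral>x. exp (- (w * exp (x - \<delta> / 2)))
        \<partial>density lborel (normal_density 0 (sqrt \<delta>))) + 60 * \<delta>\<^sup>2"
      using lognormal_laplace_lower[OF \<delta>, of w] w(1) 3(1) zero_le_power2[of \<delta>] by linarith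
    finally have "ennreal (killed_exp z) \<le> ennreal ((\<integral>x. exp (- (w * exp (x - \<delta> / 2)))
        \<partial>density lborel (normal_density 0 (sqrt \<delta>))) + 60 * \<delta>\<^sup>2)"
      using 3 by (intro ennreal_leI) (simp add: killed_exp_def)
    also have "\<dots> = ennreal (\<integral>x. exp (- (w * exp (x - \<delta> / 2)))
        \<partial>density lborel (normal_density 0 (sqrt \<delta>))) + ennreal (60 * \<delta>\<^sup>2)"
      by (intro ennreal_plus integral_nonneg) auto
    also have "ennreal (\<integral>x. exp (- (w * exp (x - \<delta> / 2)))
        \<partial>density lborel (normal_density 0 (sqrt \<delta>))) = ?T"
    proof -
      interpret N: prob_space "density lborel (normal_density 0 (sqrt \<delta>))"
        using \<delta> by (intro prob_space_normal_density) auto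
      have "integrable (density lborel (normal_density 0 (sqrt \<delta>)))
          (\<lambda>x. exp (- (w * exp (x - \<delta> / 2))))"
        by (rule N.integrable_const_bound[of _ 1]) (use w 3 in auto)
      moreover have "killed_exp (ratio_step \<delta> z x) = exp (- (w * exp (x - \<delta> / 2)))" for x
        using 3 d by (simp add: killed_exp_def ratio_step_def w_def zero_less_divide_iff)
      ultimately show ?thesis
        by (simp add: nn_integral_eq_integral)
    qed
    finally show ?thesis .
  qed
qed

text \<open>The argument \<open>x\<close> is the sequence of Gaussian increments; keeping it
  explicit makes the chain a function on the product space.\<close>

primrec ratio_chain :: "real \<Rightarrow> real \<Rightarrow> (nat \<Rightarrow> real) \<Rightarrow> nat \<Rightarrow> real" where
  "ratio_chain \<delta> \<alpha> x 0 = \<alpha>"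
| "ratio_chain \<delta> \<alpha> x (Suc k) = ratio_step \<delta> (ratio_chain \<delta> \<alpha> x k) (x k)"

lemma ratio_chain_cong:
  "(\<And>i. i < n \<Longrightarrow> x i = y i) \<Longrightarrow> ratio_chain \<delta> \<alpha> x n = ratio_chain \<delta> \<alpha> y n"
  by (induction n) auto

lemma ratio_chain_measurable:
  assumes "n \<le> m" and [simp]: "\<And>i. sets (N i) = sets borel"
  shows "(\<lambda>x. ratio_chain \<delta> \<alpha> x n) \<in> borel_measurable (PiM {..<m} N)"
  using assms(1)
proof (induction n)
  case (Suc n)
  then have [measurable]: "(\<lambda>x. ratio_chain \<delta> \<alpha> x n) \<in> borel_measurable (PiM {..<m} N)"
    by simp
  have "(\<lambda>x. x n) \<in> measurable (PiM {..<m} N) (N n)"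
    using Suc.prems by (intro measurable_component_singleton) auto
  then have [measurable]: "(\<lambda>x. x n) \<in> borel_measurable (PiM {..<m} N)"
    by (simp cong: measurable_cong_sets)
  show ?case
    unfolding ratio_chain.simps ratio_step_def by measurable
qed simp

text \<open>The denominators multiply: with A_n the Riemann sum and z_n the state, 1 - \<alpha>
  A_(n+1) = (1 - \<alpha> A_n) (1 - \<delta> z_n). The closed form carries the induction; the bound
  on the sum identifies the survival event.\<close>

lemma ratio_chain_pos_imp:
  assumes "\<alpha> > 0" "\<delta> > 0" "ratio_chain \<delta> \<alpha> x n > 0"
  defines "M \<equiv> \<lambda>k. exp ((\<Sum>i<k. x i) - real k * \<delta> / 2)"
  shows "\<alpha> * (\<delta> * (\<Sum>k<n. M k)) < 1
    \<and> ratio_chain \<delta> \<alpha> x n = \<alpha> * M n / (1 - \<alpha> * (\<delta> * (\<Sum>k<n. M k)))"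
  using assms(3)
proof (induction n)
  case 0
  then show ?case by (simp add: M_def)
next
  case (Suc n)
  let ?z = "ratio_chain \<delta> \<alpha> x n"
  have pos: "?z / (1 - \<delta> * ?z) > 0"
    using Suc.prems by (simp add: ratio_step_def zero_less_divide_iff zero_less_mult_iff mult_less_0_iff)
  \<comment> \<open>Survival at step \<open>Suc n\<close> forces survival at step \<open>n\<close>:
    numerator and denominator have the same sign, and a negative state would make the denominator
    exceed 1.\<close>
  have z: "?z > 0 \<and> 1 - \<delta> * ?z > 0"
  proof (rule ccontr)
    assume "\<not> ?thesis"
    then have "?z < 0" "1 - \<delta> * ?z < 0"
      using pos by (auto simp: zero_less_divide_iff)
    moreover from this have "\<delta> * ?z < 0"
      using assms by (simp add: mult_less_0_iff)
    ultimately show False by linarith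
  qed
  define D where "D = 1 - \<alpha> * (\<delta> * (\<Sum>k<n. M k))"
  have D: "D > 0" and z_eq: "?z = \<alpha> * M n / D"
    using Suc.IH z by (auto simp: D_def)
  have D': "1 - \<alpha> * (\<delta> * (\<Sum>k<Suc n. M k)) = D * (1 - \<delta> * ?z)"
    using D by (simp add: z_eq D_def field_simps)
  have "M (Suc n) = M n * exp (x n - \<delta> / 2)"
    by (simp add: M_def exp_add[symmetric] field_simps)
  then have "ratio_chain \<delta> \<alpha> x (Suc n) = \<alpha> * M (Suc n) / (D * (1 - \<delta> * ?z))"
    by (simp add: ratio_step_def) (simp add: z_eq mult_ac)
  moreover have "D * (1 - \<delta> * ?z) > 0"
    using D z by simp
  ultimately show ?case
    unfolding D'[symmetric] by simp
qed

text \<open>The one-step bound is applied for frozen earlier coordinates and integrated, so the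
  errors add up over the \<open>n\<close> steps. With n \<delta> = t their total is of order
  \<delta>.\<close>

lemma ratio_chain_killed_exp:
  assumes \<delta>: "0 < \<delta>" "\<delta> \<le> 1" and "\<alpha> > 0"
  shows "ennreal (exp (- (2 * \<alpha>)))
    \<le> (\<integral>\<^sup>+x. ennreal (killed_exp (ratio_chain \<delta> \<alpha> x n))
        \<partial>PiM {..<n} (\<lambda>_. density lborel (normal_density 0 (sqrt \<delta>))))
      + ennreal (real n * (60 * \<delta>\<^sup>2))"
proof -
  define N where "N = density lborel (normal_density 0 (sqrt \<delta>))"
  interpret N: prob_space N
    unfolding N_def using \<delta> by (intro prob_space_normal_density) auto
  interpret product_prob_space "\<lambda>_ :: nat. N" ..
  have sets_N [simp]: "sets N = sets borel"
    by (simp add: N_def)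
  show ?thesis
    unfolding N_def[symmetric]
  proof (induction n)
    case 0
    then show ?case
      using \<open>\<alpha> > 0\<close> by (simp add: killed_exp_def nn_integral_const emeasure_space_1 PiM_empty)
  next
    case (Suc n)
    interpret Pn: prob_space "PiM {..<n} (\<lambda>_. N)"
      by (intro prob_space_PiM N.prob_space_axioms)
    note [measurable] = ratio_chain_measurable[of n n "\<lambda>_. N", OF order_refl sets_N]
    let ?c = "ennreal (60 * \<delta>\<^sup>2)"
    have "(\<integral>\<^sup>+x. ennreal (killed_exp (ratio_chain \<delta> \<alpha> x n)) \<partial>PiM {..<n} (\<lambda>_. N))
      \<le> (\<integral>\<^sup>+x. ((\<integral>\<^sup>+y. ennreal (killed_exp (ratio_step \<delta> (ratio_chain \<delta> \<alpha> x n) y)) \<partial>N) + ?c)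
          \<partial>PiM {..<n} (\<lambda>_. N))"
      unfolding N_def by (intro nn_integral_mono killed_exp_le_step \<delta>)
    also have "\<dots> = (\<integral>\<^sup>+x. (\<integral>\<^sup>+y. ennreal (killed_exp (ratio_step \<delta> (ratio_chain \<delta> \<alpha> x n) y)) \<partial>N)
          \<partial>PiM {..<n} (\<lambda>_. N)) + ?c"
    proof (subst nn_integral_add)
      have [measurable]: "(\<lambda>p. ratio_chain \<delta> \<alpha> (fst p) n) \<in> borel_measurable (PiM {..<n} (\<lambda>_. N) \<Otimes>\<^sub>M N)"
        by (rule measurable_compose[OF measurable_fst]) measurable
      have [measurable]: "snd \<in> borel_measurable (PiM {..<n} (\<lambda>_. N) \<Otimes>\<^sub>M N)"
        using measurable_snd[of "PiM {..<n} (\<lambda>_. N)" N] by (simp cong: measurable_cong_sets)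
      show "(\<lambda>x. \<integral>\<^sup>+y. ennreal (killed_exp (ratio_step \<delta> (ratio_chain \<delta> \<alpha> x n) y)) \<partial>N)
          \<in> borel_measurable (PiM {..<n} (\<lambda>_. N))"
        unfolding ratio_step_def
        by (rule N.borel_measurable_nn_integral) (simp only: case_prod_unfold, measurable)
    qed (simp_all add: Pn.emeasure_space_1)
    also have "(\<integral>\<^sup>+x. (\<integral>\<^sup>+y. ennreal (killed_exp (ratio_step \<delta> (ratio_chain \<delta> \<alpha> x n) y)) \<partial>N)
          \<partial>PiM {..<n} (\<lambda>_. N))
      = (\<integral>\<^sup>+x. ennreal (killed_exp (ratio_chain \<delta> \<alpha> x (Suc n))) \<partial>PiM {..<Suc n} (\<lambda>_. N))"
    proof -
      \<comment> \<open>The first \<open>n\<close> states ignore coordinate \<open>n\<close>, so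
        Tonelli on the product measure splits off the last increment.\<close>
      have "ratio_chain \<delta> \<alpha> (x(n := y)) (Suc n) = ratio_step \<delta> (ratio_chain \<delta> \<alpha> x n) y" for x y
        using ratio_chain_cong[of n "x(n := y)" x] by simp
      moreover have "(\<lambda>x. ennreal (killed_exp (ratio_chain \<delta> \<alpha> x (Suc n))))
          \<in> borel_measurable (PiM (insert n {..<n}) (\<lambda>_. N))"
        using ratio_chain_measurable[of "Suc n" "Suc n" "\<lambda>_. N", OF order_refl sets_N]
        by (simp add: lessThan_Suc del: ratio_chain.simps)
      ultimately show ?thesis
        unfolding lessThan_Suc by (subst product_nn_integral_insert) auto
    qed
    finally have step: "(\<integral>\<^sup>+x. ennreal (killed_exp (ratio_chain \<delta> \<alpha> x n)) \<partial>PiM {..<n} (\<lambda>_. N))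
      \<le> (\<integral>\<^sup>+x. ennreal (killed_exp (ratio_chain \<delta> \<alpha> x (Suc n))) \<partial>PiM {..<Suc n} (\<lambda>_. N)) + ?c" .
    have "?c + ennreal (real n * (60 * \<delta>\<^sup>2)) = ennreal (real (Suc n) * (60 * \<delta>\<^sup>2))"
      by (subst ennreal_plus[symmetric]) (auto simp: algebra_simps)
    then show ?case
      using order_trans[OF Suc.IH add_right_mono[OF step]] by (simp add: add.assoc)
  qed
qed

subsection \<open>Passage to the limit\<close>

text \<open>By uniform continuity each cell of width \<open>h\<close> contributes an error of at
  most \<open>h * e\<close>; these are summed by induction over the cells. Taking
  \<open>e = r / (2 * t)\<close> leaves a total of r / 2.\<close>

lemma left_riemann_sum_tendsto_integral:
  fixes g :: "real \<Rightarrow> real"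
  assumes g: "continuous_on {0..t} g" and t: "t > 0"
  shows "(\<lambda>n. t / real (Suc n) * (\<Sum>k<Suc n. g (real k * (t / real (Suc n))))) \<longlonglongrightarrow> integral {0..t} g"
proof (rule LIMSEQ_I)
  fix r :: real
  assume "r > 0"
  define e where "e = r / (2 * t)"
  have e: "e > 0"
    using \<open>r > 0\<close> t by (simp add: e_def)
  have "uniformly_continuous_on {0..t} g"
    using g by (intro compact_uniformly_continuous) auto
  then obtain d where d: "d > 0"
    "\<And>x y. x \<in> {0..t} \<Longrightarrow> y \<in> {0..t} \<Longrightarrow> dist y x < d \<Longrightarrow> dist (g y) (g x) < e"
    using e unfolding uniformly_continuous_on_def by metis
  obtain n0 :: nat where n0: "real n0 > t / d"
    using reals_Archimedean2 by blast
  have "norm (t / real (Suc n) * (\<Sum>k<Suc n. g (real k * (t / real (Suc n)))) - integral {0..t} g) < r"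
    if n: "n \<ge> n0" for n
  proof -
    define h where "h = t / real (Suc n)"
    have h: "h > 0" "h < d"
    proof -
      have "t / d < real (Suc n)"
        using n n0 by linarith
      then show "h > 0" "h < d"
        using d t by (auto simp: h_def field_simps)
    qed
    have ht: "real (Suc n) * h = t"
      by (simp add: h_def)
    have bound: "\<bar>h * (\<Sum>j<k. g (real j * h)) - integral {0..real k * h} g\<bar> \<le> real k * h * e"
      if "k \<le> Suc n" for k
      using that
    proof (induction k)
      case (Suc k)
      have le: "real (Suc k) * h \<le> t"
        unfolding ht[symmetric] using Suc.prems h by (intro mult_right_mono) auto
      have kh: "0 \<le> real k * h" "real k * h \<le> real (Suc k) * h"
        using h by (auto intro: mult_right_mono)
      have sub: "{real k * h..real (Suc k) * h} \<subseteq> {0..t}"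
        using le kh(1) by auto
      have cont: "continuous_on {real k * h..real (Suc k) * h} g"
        using g sub by (rule continuous_on_subset)
      have "norm (integral {real k * h..real (Suc k) * h} (\<lambda>x. g (real k * h) - g x))
          \<le> e * (real (Suc k) * h - real k * h)"
      proof (rule integral_bound)
        fix x
        assume x: "x \<in> {real k * h..real (Suc k) * h}"
        then have "dist (real k * h) x < d"
          using h by (simp add: dist_real_def algebra_simps)
        then have "dist (g (real k * h)) (g x) < e"
          using x sub kh by (intro d(2)) auto
        then show "norm (g (real k * h) - g x) \<le> e"
          by (simp add: dist_norm)
      qed (use kh cont in \<open>auto intro!: continuous_intros\<close>)
      moreover have "integral {real k * h..real (Suc k) * h} (\<lambda>x. g (real k * h) - g x)
          = h * g (real k * h) - integral {real k * h..real (Suc k) * h} g"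
        using cont kh h
        by (subst integral_diff) (auto intro: integrable_continuous_real simp: algebra_simps)
      moreover have "integral {0..real k * h} g + integral {real k * h..real (Suc k) * h} g
          = integral {0..real (Suc k) * h} g"
        using kh le g
        by (intro Henstock_Kurzweil_Integration.integral_combine)
          (auto intro!: integrable_continuous_real elim: continuous_on_subset)
      ultimately show ?case
        using Suc by (simp add: algebra_simps)
    qed simp
    have "\<bar>h * (\<Sum>j<Suc n. g (real j * h)) - integral {0..t} g\<bar> \<le> t * e"
      using bound[of "Suc n"] by (simp only: ht order_refl)
    also have "\<dots> < r"
      using t \<open>r > 0\<close> by (simp add: e_def)
    finally show ?thesis
      by (simp add: h_def)
  qed
  then show "\<exists>no. \<forall>n\<ge>no. norm (t / real (Suc n) * (\<Sum>k<Suc n. g (real k * (t / real (Suc n))))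
      - integral {0..t} g) < r"
    by blast
qed

text \<open>Fatou's lemma for the complementary events: if \<open>c < Z x\<close>, then eventually
  \<open>c \<le> Y n x\<close>. The strict inequality for \<open>Y n\<close> becomes a weak one for
  the limit.\<close>

lemma (in prob_space) prob_le_limit:
  fixes Y :: "nat \<Rightarrow> 'a \<Rightarrow> real"
  assumes Y [measurable]: "\<And>n. Y n \<in> borel_measurable M" and Z [measurable]: "Z \<in> borel_measurable M"
    and lim: "AE x in M. (\<lambda>n. Y n x) \<longlonglongrightarrow> Z x"
    and e: "e \<longlonglongrightarrow> 0" and p: "\<And>n. p - e n \<le> prob {x \<in> space M. Y n x < c}"
  shows "p \<le> prob {x \<in> space M. Z x \<le> c}"
proof -
  have compl: "prob {x \<in> space M. c \<le> Y n x} \<le> 1 - p + e n" for n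
  proof -
    have "{x \<in> space M. c \<le> Y n x} = space M - {x \<in> space M. Y n x < c}"
      by auto
    then show ?thesis
      using p[of n] by (simp add: prob_compl)
  qed
  have "ennreal (prob {x \<in> space M. c < Z x}) = (\<integral>\<^sup>+x. indicator {x \<in> space M. c < Z x} x \<partial>M)"
    by (simp add: emeasure_eq_measure)
  also have "\<dots> \<le> (\<integral>\<^sup>+x. liminf (\<lambda>n. indicator {x \<in> space M. c \<le> Y n x} x) \<partial>M)"
  proof (rule nn_integral_mono_AE)
    show "AE x in M. (indicator {x \<in> space M. c < Z x} x :: ennreal)
        \<le> liminf (\<lambda>n. indicator {x \<in> space M. c \<le> Y n x} x)"
      using lim AE_space
    proof eventually_elim
      case (elim x)
      show ?case
      proof (cases "c < Z x")
        case True
        then have "eventually (\<lambda>n. c < Y n x) sequentially"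
          using elim(1) by (simp add: order_tendsto_iff)
        then have "eventually (\<lambda>n. 1 \<le> (indicator {x \<in> space M. c \<le> Y n x} x :: ennreal)) sequentially"
          by eventually_elim (use elim(2) in auto)
        then show ?thesis
          using True elim(2) by (simp add: Liminf_bounded)
      qed simp
    qed
  qed
  also have "\<dots> \<le> liminf (\<lambda>n. \<integral>\<^sup>+x. indicator {x \<in> space M. c \<le> Y n x} x \<partial>M)"
    by (intro nn_integral_liminf) simp
  also have "\<dots> \<le> liminf (\<lambda>n. ennreal (1 - p + e n))"
    by (intro Liminf_mono always_eventually allI)
      (simp add: emeasure_eq_measure ennreal_leI compl)
  also have "\<dots> = ennreal (1 - p)"
  proof (rule lim_imp_Liminf)
    have "(\<lambda>n. 1 - p + e n) \<longlonglongrightarrow> 1 - p + 0"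
      by (intro tendsto_intros e)
    then show "(\<lambda>n. ennreal (1 - p + e n)) \<longlonglongrightarrow> ennreal (1 - p)"
      by (intro tendsto_ennrealI) simp
  qed simp
  finally have "ennreal (prob {x \<in> space M. c < Z x}) \<le> ennreal (1 - p)" .
  \<comment> \<open>Since \<open>ennreal\<close> sends negative reals to 0, the sign is needed to
    return to a real inequality.\<close>
  moreover have "0 \<le> 1 - p"
  proof (rule LIMSEQ_le_const)
    show "(\<lambda>n. 1 - p + e n) \<longlonglongrightarrow> 1 - p"
      using tendsto_add[OF tendsto_const e, of "1 - p"] by simp
    show "\<exists>N. \<forall>n\<ge>N. 0 \<le> 1 - p + e n"
      using order_trans[OF measure_nonneg compl] by blast
  qed
  ultimately have "prob {x \<in> space M. c < Z x} \<le> 1 - p"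
    by simp
  moreover have "{x \<in> space M. Z x \<le> c} = space M - {x \<in> space M. c < Z x}"
    by auto
  ultimately show ?thesis
    by (simp add: prob_compl)
qed

section \<open>Infinite expectation from a heavy tail\<close>

lemma dyadic_sum_le: "(\<Sum>j<n. 2 ^ j * indicator {2 ^ Suc j..} x) \<le> x" if "0 \<le> x" for x :: real
proof (induction n)
  case (Suc n)
  show ?case
  \<comment> \<open>If the largest threshold is passed, the full geometric sum 2^(n+1) - 1 is below
    \<open>x\<close>; otherwise the last term vanishes.\<close>
  proof (cases "2 ^ Suc n \<le> x")
    case True
    have "(\<Sum>j<Suc n. 2 ^ j * indicator {2 ^ Suc j..} x) \<le> (\<Sum>j<Suc n. 2 ^ j :: real)"
      by (intro sum_mono) (auto simp: indicator_def)
    also have "\<dots> \<le> 2 ^ Suc n"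
      by (subst geometric_sum) auto
    finally show ?thesis
      using True by linarith
  qed (use Suc in auto)
qed (use that in simp)

text \<open>Each dyadic level contributes at least 2^j (1/2)^(j+1) = 1/2 to the expectation, and
  there are infinitely many levels.\<close>

lemma (in prob_space) nn_integral_infinite_if_heavy_tail:
  fixes X :: "'a \<Rightarrow> real"
  assumes [measurable]: "X \<in> borel_measurable M" and nonneg: "AE x in M. 0 \<le> X x"
    and tail: "\<And>k. (1 / 2) ^ Suc k \<le> prob {x \<in> space M. 2 ^ Suc k \<le> X x}"
  shows "(\<integral>\<^sup>+x. ennreal (X x) \<partial>M) = \<infinity>"
proof -
  have le: "of_nat n / 2 \<le> (\<integral>\<^sup>+x. ennreal (X x) \<partial>M)" for n
  proof -
    have half: "1 / 2 \<le> ennreal (2 ^ j) * emeasure M {x \<in> space M. 2 ^ Suc j \<le> X x}" for j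
    proof -
      have "1 / 2 = (2 :: real) ^ j * (1 / 2) ^ Suc j"
        by (simp add: power_one_over)
      also have "\<dots> \<le> 2 ^ j * prob {x \<in> space M. 2 ^ Suc j \<le> X x}"
        by (intro mult_left_mono tail) auto
      finally have "ennreal (1 / 2) \<le> ennreal (2 ^ j * prob {x \<in> space M. 2 ^ Suc j \<le> X x})"
        by (rule ennreal_leI)
      then show ?thesis
        by (simp add: emeasure_eq_measure ennreal_mult divide_ennreal[symmetric] divide_ennreal_def)
    qed
    have "of_nat n / 2 = (\<Sum>j<n. 1 / 2 :: ennreal)"
      by (simp add: ennreal_times_divide)
    also have "\<dots> \<le> (\<Sum>j<n. ennreal (2 ^ j) * emeasure M {x \<in> space M. 2 ^ Suc j \<le> X x})"
      by (intro sum_mono half)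
    also have "\<dots> = (\<Sum>j<n. \<integral>\<^sup>+x. ennreal (2 ^ j) * indicator {x \<in> space M. 2 ^ Suc j \<le> X x} x \<partial>M)"
      by (intro sum.cong refl nn_integral_cmult_indicator[symmetric]) simp
    also have "\<dots> = (\<integral>\<^sup>+x. (\<Sum>j<n. ennreal (2 ^ j) * indicator {x \<in> space M. 2 ^ Suc j \<le> X x} x) \<partial>M)"
      by (intro nn_integral_sum[symmetric]) simp
    also have "\<dots> \<le> (\<integral>\<^sup>+x. ennreal (X x) \<partial>M)"
    proof (rule nn_integral_mono_AE)
      show "AE x in M. (\<Sum>j<n. ennreal (2 ^ j) * indicator {x \<in> space M. 2 ^ Suc j \<le> X x} x)
          \<le> ennreal (X x)"
        using nonneg AE_space
      proof eventually_elim
        case (elim x)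
        have "(\<Sum>j<n. ennreal (2 ^ j) * indicator {x \<in> space M. 2 ^ Suc j \<le> X x} x)
            = (\<Sum>j<n. ennreal (2 ^ j * indicator {2 ^ Suc j..} (X x)))"
          by (intro sum.cong refl) (use elim(2) in \<open>auto simp: indicator_def\<close>)
        also have "\<dots> = ennreal (\<Sum>j<n. 2 ^ j * indicator {2 ^ Suc j..} (X x))"
          by (intro sum_ennreal) auto
        also have "\<dots> \<le> ennreal (X x)"
          by (intro ennreal_leI dyadic_sum_le elim)
        finally show ?case .
      qed
    qed
    finally show ?thesis .
  qed
  show ?thesis
  proof (rule ccontr)
    assume "(\<integral>\<^sup>+x. ennreal (X x) \<partial>M) \<noteq> \<infinity>"
    then obtain r where r: "0 \<le> r" "(\<integral>\<^sup>+x. ennreal (X x) \<partial>M) = ennreal r"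
      by (cases "\<integral>\<^sup>+x. ennreal (X x) \<partial>M") auto
    obtain n :: nat where n: "real n > 2 * r"
      using reals_Archimedean2 by blast
    have "ennreal (real n / 2) \<le> ennreal r"
      using le[of n] r by (simp add: divide_ennreal[symmetric] ennreal_of_nat_eq_real_of_nat)
    then show False
      using n r by simp
  qed
qed

section \<open>Riemann sums along Brownian paths\<close>

context standard_brownian_motion
begin

text \<open>The increments have the product law of the chain's noise, so the chain bound transfers
  to \<open>P\<close>. Subtracting \<open>B 0\<close> makes the sum a function of the increments
  alone, as \<open>B 0 = 0\<close> holds only almost surely.\<close>

lemma prob_riemann_sum_less:
  assumes \<delta>: "0 < \<delta>" "\<delta> \<le> 1" and \<alpha>: "\<alpha> > 0" and n: "n > 0"
  shows "exp (- (2 * \<alpha>)) - real n * (60 * \<delta>\<^sup>2)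
    \<le> prob {\<omega> \<in> space P.
        \<delta> * (\<Sum>k<n. exp (B (real k * \<delta>) \<omega> - B 0 \<omega> - real k * \<delta> / 2)) < 1 / \<alpha>}"
    (is "_ \<le> prob ?E")
proof -
  define N where "N = density lborel (normal_density 0 (sqrt \<delta>))"
  define X where "X i \<omega> = B (real (Suc i) * \<delta>) \<omega> - B (real i * \<delta>) \<omega>" for i \<omega>
  have [measurable]: "B (real i * \<delta>) \<in> borel_measurable P" for i
    using \<delta> by (intro random_variable_B) simp
  have [measurable]: "B 0 \<in> borel_measurable P"
    by (intro random_variable_B) simp
  have E [measurable]: "?E \<in> sets P"
    by measurable
  have X [measurable]: "X i \<in> borel_measurable P" for i
    unfolding X_def by measurable
  have distr_X: "distr P borel (X i) = N" for i
  proof -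
    have "distributed P lborel (X i) (normal_density 0 (sqrt (real (Suc i) * \<delta> - real i * \<delta>)))"
      unfolding X_def using \<delta> by (intro gaussian_increments) auto
    then have "distr P lborel (X i) = N"
      by (simp add: N_def distributed_def algebra_simps)
    moreover have "distr P borel (X i) = distr P lborel (X i)"
      by (rule distr_cong) auto
    ultimately show ?thesis
      by simp
  qed
  have "indep_vars (\<lambda>_. borel) (\<lambda>i \<omega>. B (real (Suc i) * \<delta>) \<omega> - B (real i * \<delta>) \<omega>) {..<n}"
    using \<delta> by (intro independent_increments[of "\<lambda>i. real i * \<delta>"]) auto
  then have indep: "indep_vars (\<lambda>_. borel) X {..<n}"
    unfolding X_def .
  have joint: "distr P (PiM {..<n} (\<lambda>_. borel)) (\<lambda>\<omega>. \<lambda>i\<in>{..<n}. X i \<omega>) = PiM {..<n} (\<lambda>_. N)"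
    using indep n by (subst (asm) indep_vars_iff_distr_eq_PiM') (auto simp: distr_X)
  have meas: "(\<lambda>x. ennreal (killed_exp (ratio_chain \<delta> \<alpha> x n))) \<in> borel_measurable (PiM {..<n} (\<lambda>_. borel))"
    using ratio_chain_measurable[of n n "\<lambda>_. borel"] by simp
  have "ennreal (exp (- (2 * \<alpha>)))
      \<le> (\<integral>\<^sup>+x. ennreal (killed_exp (ratio_chain \<delta> \<alpha> x n)) \<partial>PiM {..<n} (\<lambda>_. N))
        + ennreal (real n * (60 * \<delta>\<^sup>2))"
    unfolding N_def using \<delta> \<alpha> by (rule ratio_chain_killed_exp)
  also have "(\<integral>\<^sup>+x. ennreal (killed_exp (ratio_chain \<delta> \<alpha> x n)) \<partial>PiM {..<n} (\<lambda>_. N))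
      = (\<integral>\<^sup>+\<omega>. ennreal (killed_exp (ratio_chain \<delta> \<alpha> (\<lambda>i\<in>{..<n}. X i \<omega>) n)) \<partial>P)"
    unfolding joint[symmetric] using meas by (subst nn_integral_distr) auto
  \<comment> \<open>\<open>killed_exp\<close> is at most 1 and vanishes unless the chain is alive,
    which puts \<omega> into the event.\<close>
  also have "\<dots> \<le> (\<integral>\<^sup>+\<omega>. indicator ?E \<omega> \<partial>P)"
  proof (rule nn_integral_mono)
    fix \<omega>
    assume \<omega>: "\<omega> \<in> space P"
    let ?x = "\<lambda>i\<in>{..<n}. X i \<omega>"
    show "ennreal (killed_exp (ratio_chain \<delta> \<alpha> ?x n)) \<le> indicator ?E \<omega>"
    proof (cases "ratio_chain \<delta> \<alpha> ?x n > 0")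
      case True
      have "\<alpha> * (\<delta> * (\<Sum>k<n. exp ((\<Sum>i<k. ?x i) - real k * \<delta> / 2))) < 1"
        using ratio_chain_pos_imp[OF \<alpha> \<delta>(1) True] by simp
      moreover have tele: "(\<Sum>i<k. ?x i) = B (real k * \<delta>) \<omega> - B 0 \<omega>" if "k < n" for k
      proof -
        have "(\<Sum>i<k. ?x i) = (\<Sum>i<k. X i \<omega>)"
          using that by (intro sum.cong) auto
        also have "\<dots> = B (real k * \<delta>) \<omega> - B (real 0 * \<delta>) \<omega>"
          unfolding X_def by (rule sum_lessThan_telescope)
        finally show ?thesis by simp
      qed
      moreover have "(\<Sum>k<n. exp ((\<Sum>i<k. ?x i) - real k * \<delta> / 2))
          = (\<Sum>k<n. exp (B (real k * \<delta>) \<omega> - B 0 \<omega> - real k * \<delta> / 2))"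
        by (intro sum.cong refl) (simp only: lessThan_iff tele)
      ultimately have "\<omega> \<in> ?E"
        using \<omega> \<alpha> by (simp only: mem_Collect_eq pos_less_divide_eq mult.commute[of _ \<alpha>])
      then show ?thesis
        using True \<alpha> by (simp add: killed_exp_def)
    qed (simp add: killed_exp_def)
  qed
  also have "\<dots> = ennreal (prob ?E)"
    by (simp add: emeasure_eq_measure)
  finally have "ennreal (exp (- (2 * \<alpha>))) \<le> ennreal (prob ?E + real n * (60 * \<delta>\<^sup>2))"
    by (simp add: ennreal_plus)
  then have "exp (- (2 * \<alpha>)) \<le> prob ?E + real n * (60 * \<delta>\<^sup>2)"
    by (subst (asm) ennreal_le_iff) auto
  then show ?thesis
    by simp
qed

text \<open>On a continuous path started at 0 the integrand is continuous and positive, so it has a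
  positive minimum on the compact interval; this makes the integral positive.\<close>

lemma AE_exp_functional_limit:
  assumes t: "t > 0"
  shows "AE \<omega> in P. exp_functional B t \<omega> > 0 \<and>
    (\<lambda>n. t / real (Suc n) * (\<Sum>k<Suc n. exp (B (real k * (t / real (Suc n))) \<omega> - B 0 \<omega>
      - real k * (t / real (Suc n)) / 2))) \<longlonglongrightarrow> exp_functional B t \<omega>"
  using continuous_paths starts_at_zero
proof eventually_elim
  case (elim \<omega>)
  define g where "g s = exp_martingale B s \<omega>" for s
  have B: "continuous_on {0..t} (\<lambda>s. B s \<omega>)"
    using elim(1) by (rule continuous_on_subset) auto
  have g: "continuous_on {0..t} g"
    unfolding g_def exp_martingale_def by (intro continuous_intros B) auto
  have fun_eq: "exp_functional B t \<omega> = integral {0..t} g"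
    unfolding exp_functional_def g_def[symmetric]
    by (intro set_borel_integral_eq_integral borel_integrable_atLeastAtMost') (rule g)
  obtain s0 where s0: "s0 \<in> {0..t}" "\<And>s. s \<in> {0..t} \<Longrightarrow> g s0 \<le> g s"
    using continuous_attains_inf[of "{0..t}" g] g t by auto
  have "integral {0..t} (\<lambda>_. g s0) \<le> integral {0..t} g"
    using s0 g by (intro integral_le integrable_continuous_real) auto
  moreover have "integral {0..t} (\<lambda>_. g s0) > 0"
    using t by (simp add: g_def exp_martingale_def)
  ultimately have "integral {0..t} g > 0"
    by linarith
  then show ?case
    using left_riemann_sum_tendsto_integral[OF g t] elim(2)
    by (simp add: fun_eq g_def exp_martingale_def)
qed

end

theorem corollary4p3:
  fixes P :: "'a measure" and B :: "real \<Rightarrow> 'a \<Rightarrow> real" and t :: real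
  assumes "standard_brownian_motion P B" and "t > 0"
  shows "(\<integral>\<^sup>+ \<omega>. ennreal (exp (2 / exp_functional B t \<omega>)) \<partial>P) = \<infinity>"
proof -
  interpret standard_brownian_motion P B by fact
  define \<delta> where "\<delta> n = t / real (Suc n)" for n
  define Y where "Y n \<omega> = \<delta> n * (\<Sum>k<Suc n. exp (B (real k * \<delta> n) \<omega> - B 0 \<omega> - real k * \<delta> n / 2))"
    for n \<omega>
  \<comment> \<open>As a limit of measurable sums, \<open>Z\<close> is measurable by construction;
    \<open>exp_functional B t\<close> is only shown to agree with it almost surely.\<close>
  define Z where "Z \<omega> = lim (\<lambda>n. Y n \<omega>)" for \<omega>
  have \<delta>_pos: "\<delta> n > 0" for n
    using \<open>t > 0\<close> by (simp add: \<delta>_def)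
  have [measurable]: "B (real k * \<delta> n) \<in> borel_measurable P" for k n
    using \<delta>_pos[of n] by (intro random_variable_B) simp
  have [measurable]: "B 0 \<in> borel_measurable P"
    by (intro random_variable_B) simp
  have Y [measurable]: "Y n \<in> borel_measurable P" for n
    unfolding Y_def by measurable
  have Z [measurable]: "Z \<in> borel_measurable P"
    unfolding Z_def by measurable
  have lim: "AE \<omega> in P. (\<lambda>n. Y n \<omega>) \<longlonglongrightarrow> Z \<omega> \<and> Z \<omega> = exp_functional B t \<omega> \<and> Z \<omega> > 0"
    using AE_exp_functional_limit[OF \<open>t > 0\<close>]
  proof eventually_elim
    case (elim \<omega>)
    then have "(\<lambda>n. Y n \<omega>) \<longlonglongrightarrow> exp_functional B t \<omega>"
      unfolding Y_def \<delta>_def by blast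
    moreover from this have "Z \<omega> = exp_functional B t \<omega>"
      unfolding Z_def by (rule limI)
    ultimately show ?case
      using elim by metis
  qed
  \<comment> \<open>Shifting the index by \<open>n0\<close> brings the mesh below 1, as the one-step
    estimate requires.\<close>
  obtain n0 :: nat where n0: "real n0 \<ge> t"
    using real_arch_simple by blast
  have tail: "exp (- (2 * \<alpha>)) \<le> prob {\<omega> \<in> space P. Z \<omega> \<le> 1 / \<alpha>}" if "\<alpha> > 0" for \<alpha>
  proof (rule prob_le_limit[of "\<lambda>n. Y (n + n0)" Z])
    show "AE \<omega> in P. (\<lambda>n. Y (n + n0) \<omega>) \<longlonglongrightarrow> Z \<omega>"
      using lim by eventually_elim (auto intro: LIMSEQ_ignore_initial_segment)
    have "(\<lambda>n. 60 * t\<^sup>2 / real (Suc n)) \<longlonglongrightarrow> 0"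
      using tendsto_mult_right_zero[OF LIMSEQ_inverse_real_of_nat, of "60 * t\<^sup>2"]
      by (simp add: divide_inverse)
    then show "(\<lambda>n. 60 * t\<^sup>2 / real (Suc (n + n0))) \<longlonglongrightarrow> 0"
      by (rule LIMSEQ_ignore_initial_segment)
    show "exp (- (2 * \<alpha>)) - 60 * t\<^sup>2 / real (Suc (n + n0))
        \<le> prob {\<omega> \<in> space P. Y (n + n0) \<omega> < 1 / \<alpha>}" for n
    proof -
      have "\<delta> (n + n0) \<le> 1"
        using n0 by (simp add: \<delta>_def)
      moreover have "real (Suc (n + n0)) * (60 * (\<delta> (n + n0))\<^sup>2) = 60 * t\<^sup>2 / real (Suc (n + n0))"
        by (simp add: \<delta>_def power2_eq_square del: of_nat_Suc)
      ultimately show ?thesis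
        using prob_riemann_sum_less[OF \<delta>_pos _ that, of "n + n0" "Suc (n + n0)"]
        unfolding Y_def by simp
    qed
  qed auto
  have "(\<integral>\<^sup>+ \<omega>. ennreal (exp (2 / exp_functional B t \<omega>)) \<partial>P) = (\<integral>\<^sup>+ \<omega>. ennreal (exp (2 / Z \<omega>)) \<partial>P)"
    using lim by (intro nn_integral_cong_AE) auto
  also have "\<dots> = \<infinity>"
  proof (rule nn_integral_infinite_if_heavy_tail)
    fix k
    \<comment> \<open>Solves exp(2\<alpha>) = 2^(k+1). The tail bound is then exactly (1/2)^(k+1),
      and 0 < Z \<le> 1/\<alpha> gives exp(2/Z) \<ge> 2^(k+1).\<close>
    define \<alpha> where "\<alpha> = real (Suc k) * ln 2 / 2"
    have "2 * \<alpha> = real (Suc k) * ln 2"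
      by (simp add: \<alpha>_def)
    then have \<alpha>: "\<alpha> > 0" "exp (2 * \<alpha>) = 2 ^ Suc k"
      by (simp add: \<alpha>_def) (simp only: \<open>2 * \<alpha> = _\<close> exp_of_nat_mult, simp)
    have "(1 / 2) ^ Suc k = exp (- (2 * \<alpha>))"
      unfolding exp_minus \<alpha>(2) by (simp add: power_one_over inverse_eq_divide)
    also have "\<dots> \<le> prob {\<omega> \<in> space P. Z \<omega> \<le> 1 / \<alpha>}"
      by (rule tail) fact
    also have "\<dots> \<le> prob {\<omega> \<in> space P. 2 ^ Suc k \<le> exp (2 / Z \<omega>)}"
    proof (rule finite_measure_mono_AE)
      show "AE \<omega> in P. \<omega> \<in> {\<omega> \<in> space P. Z \<omega> \<le> 1 / \<alpha>}
          \<longrightarrow> \<omega> \<in> {\<omega> \<in> space P. 2 ^ Suc k \<le> exp (2 / Z \<omega>)}"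
        using lim
      proof eventually_elim
        case (elim \<omega>)
        then show ?case
          unfolding \<alpha>(2)[symmetric] using \<alpha>(1) by (auto simp: field_simps)
      qed
    qed measurable
    finally show "(1 / 2) ^ Suc k \<le> prob {\<omega> \<in> space P. 2 ^ Suc k \<le> exp (2 / Z \<omega>)}" .
  qed auto
  finally show ?thesis .
qed

end
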